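(* Any asymptotically exact streaming algorithm for estimating $F_0$ requires $\Omega(n)$ memory.
   Context: The input is a stream of integers from $[N]$; for the prefix of length $n$, $m_i$ is the number of occurrences of $i$ and $F_0=|\{i: m_i>0\}|$ is the number of distinct elements. Here an asymptotically exact streaming algorithm for $F_0$ means a one-pass streaming algorithm that, on an infinite input stream, after every prefix of length $n$ maintains an estimate $\tilde F_0$ such that, with probability at least $1-\delta$ ($\delta<1/2$), $\tilde F_0/F_0\to 1$ as $n\to\infty$; the claim is that such an algorithm must use $\Omega(n)$ bits of memory (in the worst case over inputs), i.e. no such algorithm with sublinear (in particular polylogarithmic) space exists. *)

theory Defs
  imports "HOL-Probability.Probability" "HOL-Probability.Essential_Supremum"
begin

text \<open>
  A randomised one-pass algorithm whose memory content is a bit string. The outcome of the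
  random source is passed to every step, together with the number of items read so far; neither
  is charged as memory. This subsumes algorithms that draw fresh coins in each step (take the
  sample space to be sequences and read position \<open>n\<close> in step \<open>n\<close>) as well as
  algorithms without shared randomness or without a clock.
\<close>

record 'w stream_alg =
  coins :: "'w measure"
  init_mem :: "'w \<Rightarrow> bool list"
  update_mem :: "'w \<Rightarrow> nat \<Rightarrow> bool list \<Rightarrow> nat \<Rightarrow> bool list"
  output_est :: "'w \<Rightarrow> nat \<Rightarrow> bool list \<Rightarrow> real"

definition streaming_algorithm :: "'w stream_alg \<Rightarrow> bool" where
  "streaming_algorithm A \<longleftrightarrow>
     prob_space (coins A) \<and>
     init_mem A \<in> coins A \<rightarrow>\<^sub>M count_space UNIV \<and>
     (\<forall>n s a. (\<lambda>w. update_mem A w n s a) \<in> coins A \<rightarrow>\<^sub>M count_space UNIV) \<and>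
     (\<forall>n s. (\<lambda>w. output_est A w n s) \<in> borel_measurable (coins A))"

text \<open>An infinite stream \<open>x\<close> has the items \<open>x 0, x 1, \<dots>\<close>; its prefix of
  length \<open>n\<close> consists of the items with index less than \<open>n\<close>.\<close>

definition streams_over :: "nat \<Rightarrow> (nat \<Rightarrow> nat) set" where
  "streams_over N = {x. \<forall>k. x k \<in> {1..N}}"

definition occurrences :: "(nat \<Rightarrow> nat) \<Rightarrow> nat \<Rightarrow> nat \<Rightarrow> nat" where
  "occurrences x n i = card {k. k < n \<and> x k = i}"

definition F0 :: "nat \<Rightarrow> (nat \<Rightarrow> nat) \<Rightarrow> nat \<Rightarrow> nat" where
  "F0 N x n = card {i \<in> {1..N}. occurrences x n i > 0}"

primrec memory :: "'w stream_alg \<Rightarrow> (nat \<Rightarrow> nat) \<Rightarrow> 'w \<Rightarrow> nat \<Rightarrow> bool list" where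
  "memory A x w 0 = init_mem A w"
| "memory A x w (Suc n) = update_mem A w n (memory A x w n) (x n)"

definition estimate :: "'w stream_alg \<Rightarrow> (nat \<Rightarrow> nat) \<Rightarrow> 'w \<Rightarrow> nat \<Rightarrow> real" where
  "estimate A x w n = output_est A w n (memory A x w n)"

definition asymptotically_exact_F0 :: "real \<Rightarrow> nat \<Rightarrow> 'w stream_alg \<Rightarrow> bool" where
  "asymptotically_exact_F0 \<delta> N A \<longleftrightarrow>
     streaming_algorithm A \<and>
     (\<forall>x \<in> streams_over N.
        measure (coins A)
          {w \<in> space (coins A). (\<lambda>n. estimate A x w n / real (F0 N x n)) \<longlonglongrightarrow> 1} \<ge> 1 - \<delta>)"

text \<open>Number of memory bits held after a prefix of length \<open>n\<close>, in the worst case over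
  the input and over the coin outcomes (up to null sets).\<close>

definition memory_bits :: "'w stream_alg \<Rightarrow> nat \<Rightarrow> nat \<Rightarrow> ereal" where
  "memory_bits A N n =
     (SUP x \<in> streams_over N. esssup (coins A) (\<lambda>w. ereal (real (length (memory A x w n)))))"

end

theory Submission
  imports Defs
begin

text \<open>
  Put \<open>m = n div 2\<close>. A set \<open>B \<subseteq> {..<m}\<close> is written into a prefix of length
  \<open>n\<close> by choosing, for each \<open>j < m\<close>, one item of the pair \<open>2j+1, 2j+2\<close>. If the
  stream then repeats \<open>2j+2\<close> forever, \<open>F\<^sub>0\<close> is finally \<open>m\<close> or
  \<open>m+1\<close> according to whether \<open>j \<in> B\<close>, so the memory after \<open>n\<close> items, together
  with the coins, determines each bit of \<open>B\<close> with probability at least \<open>1 - \<delta>\<close>.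
  By averaging, one coin outcome recovers a fraction \<open>1 - \<delta> > 1/2\<close> of all bits of all sets. A
  Chernoff-type count shows that a code book recovering that many bits has size exponential in \<open>m\<close>.
\<close>

section \<open>Code books that recover more than half of the bits\<close>

text \<open>The linear terms of the quadratic bounds for \<open>exp l\<close> and
  \<open>exp (- l)\<close> cancel. The bound for \<open>exp (- l)\<close> goes through the
  reciprocal, where (1 - l + l^2)(1 + l) = 1 + l^3 \<ge> 1.\<close>

lemma exp_add_exp_minus_le:
  fixes l :: real
  assumes "0 \<le> l" "l \<le> 1"
  shows "exp l + exp (- l) \<le> 2 * exp (l\<^sup>2)"
proof -
  have "exp l \<le> 1 + l + l\<^sup>2"
    using exp_bound[of l] assms by simp
  moreover have "exp (- l) \<le> 1 - l + l\<^sup>2"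
  proof -
    have "exp (- l) = inverse (exp l)" by (simp add: exp_minus)
    also have "\<dots> \<le> inverse (1 + l)"
      using exp_ge_add_one_self[of l] assms by (intro le_imp_inverse_le) auto
    also have "\<dots> \<le> 1 - l + l\<^sup>2"
    proof -
      have "(1 - l + l\<^sup>2) * (1 + l) = 1 + l ^ 3"
        by (simp add: algebra_simps power2_eq_square power3_eq_cube)
      then have "1 \<le> (1 - l + l\<^sup>2) * (1 + l)" using assms by simp
      then show ?thesis using assms by (simp add: inverse_eq_divide divide_le_eq)
    qed
    finally show ?thesis .
  qed
  moreover have "1 + l\<^sup>2 \<le> exp (l\<^sup>2)" by (rule exp_ge_add_one_self)
  ultimately show ?thesis by linarith
qed

definition agreement :: "'a set \<Rightarrow> 'a set \<Rightarrow> 'a set \<Rightarrow> nat" where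
  "agreement I B D = card {j \<in> I. j \<in> D \<longleftrightarrow> j \<in> B}"

text \<open>Up to the factor 2^|I| this is the moment generating function of a sum of independent
  signs: 2 * agreement - |I| adds +1 for each matching element and -1 for each mismatch. The
  exponential factors over I, and summing over B leaves one factor per element that is the same for
  every D.\<close>

lemma sum_exp_agreement:
  fixes l :: real
  assumes "finite I"
  shows "(\<Sum>B\<in>Pow I. exp (l * (2 * real (agreement I B D) - real (card I))))
    = (exp l + exp (- l)) ^ card I"
proof -
  \<comment> \<open>\<open>f j\<close> is the factor of j when j lies in B, \<open>g j\<close> the
    factor when it does not.\<close>
  define f where "f j = exp (if j \<in> D then l else - l)" for j
  define g where "g j = exp (if j \<in> D then - l else l)" for j
  have "(\<Sum>B\<in>Pow I. exp (l * (2 * real (agreement I B D) - real (card I))))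
      = (\<Sum>B\<in>Pow I. prod f B * prod g (I - B))"
  proof (rule sum.cong[OF refl])
    fix B assume "B \<in> Pow I"
    then have B: "B \<subseteq> I" "finite B" using assms finite_subset by auto
    have pw: "prod f B * prod g (I - B)
        = (\<Prod>j\<in>I. exp (if j \<in> D \<longleftrightarrow> j \<in> B then l else - l))"
    proof -
      have "prod f B = (\<Prod>j\<in>B. exp (if j \<in> D \<longleftrightarrow> j \<in> B then l else - l))"
        by (rule prod.cong) (auto simp: f_def)
      moreover have "prod g (I - B) = (\<Prod>j\<in>I - B. exp (if j \<in> D \<longleftrightarrow> j \<in> B then l else - l))"
        by (rule prod.cong) (auto simp: g_def)
      ultimately show ?thesis
        by (simp only: prod.subset_diff[OF B(1) assms] mult.commute)
    qed
    have "(\<Sum>j\<in>I. if j \<in> D \<longleftrightarrow> j \<in> B then l else - l)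
        = (\<Sum>j\<in>I. 2 * l * of_bool (j \<in> D \<longleftrightarrow> j \<in> B) - l)"
      by (rule sum.cong) auto
    also have "\<dots> = 2 * l * (\<Sum>j\<in>I. of_bool (j \<in> D \<longleftrightarrow> j \<in> B)) - real (card I) * l"
      by (simp add: sum_subtractf sum_distrib_left)
    also have "(\<Sum>j\<in>I. of_bool (j \<in> D \<longleftrightarrow> j \<in> B)) = real (agreement I B D)"
      unfolding agreement_def using assms by (simp add: Int_def)
    finally show "exp (l * (2 * real (agreement I B D) - real (card I)))
        = prod f B * prod g (I - B)"
      unfolding pw exp_sum[OF assms, symmetric] by (simp add: algebra_simps)
  qed
  also have "\<dots> = (\<Prod>j\<in>I. f j + g j)"
    by (rule prod_add[OF assms, symmetric])
  also have "\<dots> = (\<Prod>j\<in>I. exp l + exp (- l))"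
    by (rule prod.cong) (auto simp: f_def g_def)
  finally show ?thesis by simp
qed

text \<open>Exponential moments and a union bound over code words: for a fixed decoded set few B
  agree in noticeably more than half of the places, so a large average agreement needs many code
  words.\<close>

lemma code_book_size:
  fixes enc :: "'a set \<Rightarrow> 's" and dec :: "'s \<Rightarrow> 'a set" and \<eta> :: real
  assumes I: "finite I" and T: "finite T" and enc: "\<And>B. B \<subseteq> I \<Longrightarrow> enc B \<in> T"
    and \<eta>: "0 \<le> \<eta>" "\<eta> \<le> 1"
    and agree: "(\<Sum>B\<in>Pow I. 2 * real (agreement I B (dec (enc B)))) \<ge> (1 + \<eta>) * real (card I) * 2 ^ card I"
  shows "exp (\<eta>\<^sup>2 * real (card I) / 4) \<le> real (card T)"
proof -
  \<comment> \<open>This choice maximises l\<eta>m - l^2 m, the exponent obtained at the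
    end.\<close>
  define l where "l = \<eta> / 2"
  define m where "m = card I"
  define t where "t B D = l * (2 * real (agreement I B D) - real m)" for B D
  define t0 where "t0 = l * \<eta> * real m"
  have l: "0 \<le> l" "l \<le> 1" using \<eta> by (auto simp: l_def)
  have cP: "real (card (Pow I)) = 2 ^ m" using I by (simp add: card_Pow m_def)
  have "t0 * 2 ^ m \<le> l * ((\<Sum>B\<in>Pow I. 2 * real (agreement I B (dec (enc B)))) - real m * 2 ^ m)"
  proof -
    have "\<eta> * real m * 2 ^ m \<le> (\<Sum>B\<in>Pow I. 2 * real (agreement I B (dec (enc B)))) - real m * 2 ^ m"
      using agree by (simp add: m_def algebra_simps)
    from mult_left_mono[OF this l(1)] show ?thesis by (simp add: t0_def mult.assoc)
  qed
  also have "\<dots> = (\<Sum>B\<in>Pow I. t B (dec (enc B)))"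
    using cP by (simp add: t_def sum_subtractf flip: sum_distrib_left)
  finally have avg: "t0 * 2 ^ m \<le> (\<Sum>B\<in>Pow I. t B (dec (enc B)))" .
  \<comment> \<open>Jensen's inequality, through the tangent of exp at \<open>t0\<close>.\<close>
  have "exp t0 * 2 ^ m \<le> exp t0 * (\<Sum>B\<in>Pow I. 1 + (t B (dec (enc B)) - t0))"
    using avg cP by (simp add: sum.distrib sum_subtractf algebra_simps)
  also have "\<dots> \<le> exp t0 * (\<Sum>B\<in>Pow I. exp (t B (dec (enc B)) - t0))"
    by (intro mult_left_mono sum_mono exp_ge_add_one_self) auto
  also have "\<dots> = (\<Sum>B\<in>Pow I. exp (t B (dec (enc B))))"
    by (simp add: sum_distrib_left exp_diff)
  \<comment> \<open>Bounding the term at \<open>enc B\<close> by the sum over all of T frees s from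
    B; after the swap \<open>dec s\<close> is a fixed set and \<open>sum_exp_agreement\<close>
    applies.\<close>
  also have "\<dots> \<le> (\<Sum>B\<in>Pow I. \<Sum>s\<in>T. exp (t B (dec s)))"
    using T enc by (intro sum_mono member_le_sum[where f = "\<lambda>s. exp (t _ (dec s))"]) auto
  also have "\<dots> = (\<Sum>s\<in>T. \<Sum>B\<in>Pow I. exp (t B (dec s)))"
    by (rule sum.swap)
  also have "\<dots> = real (card T) * (exp l + exp (- l)) ^ m"
    using sum_exp_agreement[OF I] by (simp add: t_def m_def)
  also have "\<dots> \<le> real (card T) * (2 * exp (l\<^sup>2)) ^ m"
    by (intro mult_left_mono power_mono exp_add_exp_minus_le l) auto
  also have "\<dots> = real (card T) * exp (real m * l\<^sup>2) * 2 ^ m"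
    by (simp add: power_mult_distrib exp_of_nat_mult)
  finally have "exp t0 \<le> real (card T) * exp (real m * l\<^sup>2)" by simp
  then have "exp (t0 - real m * l\<^sup>2) \<le> real (card T)"
    by (simp add: exp_diff divide_le_eq)
  moreover have "t0 - real m * l\<^sup>2 = \<eta>\<^sup>2 * real (card I) / 4"
    by (simp add: t0_def l_def m_def power2_eq_square field_simps)
  ultimately show ?thesis by simp
qed

lemma finite_bool_lists_le: "finite {xs :: bool list. length xs \<le> L}"
  using finite_lists_length_le[of "UNIV :: bool set" L] by simp

lemma card_bool_lists_le: "card {xs :: bool list. length xs \<le> L} \<le> 2 ^ (L + 1)"
proof -
  have "card {xs :: bool list. length xs \<le> L} = (\<Sum>i\<le>L. 2 ^ i)"
    using card_lists_length_le[of "UNIV :: bool set" L] by simp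
  also have "\<dots> \<le> 2 ^ (L + 1)"
    by (induction L) auto
  finally show ?thesis .
qed

section \<open>The hard streams\<close>

lemma memory_cong_suffix:
  assumes "memory A x w n = memory A y w n" "\<And>k. k \<ge> n \<Longrightarrow> x k = y k" "n \<le> k"
  shows "memory A x w k = memory A y w k"
  using assms(3) by (induction k rule: dec_induct) (use assms(1,2) in auto)

lemma memory_cong_prefix:
  assumes "\<And>k. k < n \<Longrightarrow> x k = y k"
  shows "memory A x w n = memory A y w n"
  using assms by (induction n) auto

lemma F0_eq_card_image:
  assumes "x \<in> streams_over N"
  shows "F0 N x n = card (x ` {..<n})"
proof -
  have "occurrences x n i > 0 \<longleftrightarrow> i \<in> x ` {..<n}" for i
    unfolding occurrences_def by (subst card_gt_0_iff) auto
  then have "{i \<in> {1..N}. occurrences x n i > 0} = x ` {..<n}"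
    using assms by (auto simp: streams_over_def)
  then show ?thesis by (simp add: F0_def)
qed

definition bit_item :: "nat set \<Rightarrow> nat \<Rightarrow> nat" where
  "bit_item B k = (if k \<in> B then 2 * k + 2 else 2 * k + 1)"

text \<open>The positions from n div 2 up to n are padding: they repeat an item already read, so the
  prefix has length exactly n and uses only items up to n. The prefix is independent of j.\<close>

definition index_stream :: "nat \<Rightarrow> nat set \<Rightarrow> nat \<Rightarrow> nat \<Rightarrow> nat" where
  "index_stream n B j k =
     (if k < n div 2 then bit_item B k else if k < n then bit_item B 0 else 2 * j + 2)"

lemma index_stream_in_streams_over:
  assumes "j < n div 2" "n \<le> N"
  shows "index_stream n B j \<in> streams_over N"
  using assms by (auto simp: streams_over_def index_stream_def bit_item_def)

lemma inj_bit_item: "inj_on (bit_item B) S"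
  by (rule inj_on_inverseI[where g = "\<lambda>i. (i - 1) div 2"]) (simp add: bit_item_def)

lemma F0_index_stream:
  assumes j: "j < n div 2" and "n \<le> N" and "n < k"
  shows "F0 N (index_stream n B j) k = (if j \<in> B then n div 2 else Suc (n div 2))"
proof -
  let ?P = "bit_item B ` {..<n div 2}"
  have "index_stream n B j ` {..<k} = insert (2 * j + 2) ?P"
  proof (intro equalityI subsetI)
    fix i assume "i \<in> index_stream n B j ` {..<k}"
    then show "i \<in> insert (2 * j + 2) ?P"
      using j by (auto simp: index_stream_def split: if_splits)
  next
    fix i assume "i \<in> insert (2 * j + 2) ?P"
    then consider "i = 2 * j + 2" | r where "r < n div 2" "i = bit_item B r"
      by blast
    then show "i \<in> index_stream n B j ` {..<k}"
    proof cases
      case 1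
      \<comment> \<open>The repeated item first appears at index n, so a prefix contains it for sure
        only when its length exceeds n.\<close>
      then have "i = index_stream n B j n" using not_less[of n "n div 2"] by (simp add: index_stream_def)
      then show ?thesis using \<open>n < k\<close> by blast
    next
      case 2
      then have "i = index_stream n B j r" "r < k"
        using \<open>n < k\<close> by (simp_all add: index_stream_def)
      then show ?thesis by blast
    qed
  qed
  moreover have "2 * j + 2 \<in> ?P \<longleftrightarrow> j \<in> B"
  proof
    assume "2 * j + 2 \<in> ?P"
    then obtain r where "2 * j + 2 = bit_item B r" by auto
    then show "j \<in> B" by (auto simp: bit_item_def split: if_splits) presburger
  next
    assume "j \<in> B"
    then have "2 * j + 2 = bit_item B j" by (simp add: bit_item_def)
    then show "2 * j + 2 \<in> ?P" using j by blast
  qed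
  ultimately show ?thesis
    by (simp add: F0_eq_card_image index_stream_in_streams_over assms card_insert_if card_image inj_bit_item)
qed

definition succeeds :: "'w stream_alg \<Rightarrow> nat \<Rightarrow> (nat \<Rightarrow> nat) \<Rightarrow> 'w set" where
  "succeeds A N x =
     {w \<in> space (coins A). (\<lambda>n. estimate A x w n / real (F0 N x n)) \<longlonglongrightarrow> 1}"

text \<open>As \<open>F0\<close> is eventually a positive constant on such a stream, convergence of
  the ratio is convergence of the estimate itself.\<close>

lemma estimate_index_stream_tendsto:
  assumes "w \<in> succeeds A N (index_stream n B j)" "j < n div 2" "n \<le> N"
  shows "estimate A (index_stream n B j) w \<longlonglongrightarrow> real (if j \<in> B then n div 2 else Suc (n div 2))"
proof -
  let ?v = "real (if j \<in> B then n div 2 else Suc (n div 2))" and ?x = "index_stream n B j"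
  have "(\<lambda>k. estimate A ?x w k / real (F0 N ?x k) * ?v) \<longlonglongrightarrow> 1 * ?v"
    using assms(1) by (intro tendsto_mult tendsto_const) (simp add: succeeds_def)
  moreover have "\<forall>\<^sub>F k in sequentially. estimate A ?x w k / real (F0 N ?x k) * ?v = estimate A ?x w k"
    using eventually_gt_at_top[of n]
    by eventually_elim (use assms in \<open>auto simp: F0_index_stream\<close>)
  ultimately show ?thesis
    using tendsto_cong by fastforce
qed

text \<open>From time n on both runs see the same items, coins and clock, so their estimates
  coincide. Unequal bits would force the two distinct limits m and m + 1, with m = n div 2.\<close>

lemma same_memory_same_bit:
  assumes "w \<in> succeeds A N (index_stream n B j)" "w \<in> succeeds A N (index_stream n B' j)"
    and "j < n div 2" "n \<le> N"
    and "memory A (index_stream n B j) w n = memory A (index_stream n B' j) w n"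
  shows "j \<in> B \<longleftrightarrow> j \<in> B'"
proof -
  have "memory A (index_stream n B j) w k = memory A (index_stream n B' j) w k" if "n \<le> k" for k
    using assms(5) _ that by (rule memory_cong_suffix) (auto simp: index_stream_def)
  then have "\<forall>\<^sub>F k in sequentially. estimate A (index_stream n B j) w k = estimate A (index_stream n B' j) w k"
    by (intro eventually_sequentiallyI[of n]) (simp add: estimate_def)
  then have "estimate A (index_stream n B j) w \<longlonglongrightarrow> real (if j \<in> B' then n div 2 else Suc (n div 2))"
    using estimate_index_stream_tendsto[OF assms(2-4)] tendsto_cong by fast
  from LIMSEQ_unique[OF estimate_index_stream_tendsto[OF assms(1,3,4)] this]
  show ?thesis by (auto split: if_splits)
qed

section \<open>The lower bound\<close>

lemma AE_length_memory_le:
  assumes "x \<in> streams_over N" "memory_bits A N n \<le> ereal r"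
  shows "AE w in coins A. real (length (memory A x w n)) \<le> r"
proof -
  let ?f = "\<lambda>w. ereal (real (length (memory A x w n)))"
  have le: "esssup (coins A) ?f \<le> ereal r"
    using assms by (auto simp: memory_bits_def SUP_le_iff)
  from esssup_AE[of ?f "coins A"] show ?thesis
    using le by (auto elim!: eventually_mono dest: order_trans)
qed

lemma memory_exponential:
  assumes ex: "asymptotically_exact_F0 \<delta> N A" and \<delta>: "0 \<le> \<delta>" "\<delta> < 1 / 2"
    and n: "2 \<le> n" "n \<le> N"
    and mem: "memory_bits A N n \<le> ereal r"
  shows "exp ((1 - 2 * \<delta>)\<^sup>2 * real (n div 2) / 4) \<le> 2 ^ (nat \<lfloor>r\<rfloor> + 1)"
proof -
  define m where "m = n div 2"
  let ?I = "{..<m}" and ?M = "coins A"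
  let ?x = "index_stream n" and ?T = "{xs :: bool list. length xs \<le> nat \<lfloor>r\<rfloor>}"
  interpret prob_space ?M
    using ex by (simp add: asymptotically_exact_F0_def streaming_algorithm_def)
  have stream: "?x B j \<in> streams_over N" if "j < m" for B j
    using that n by (auto simp: m_def index_stream_in_streams_over)
  have pr: "prob (succeeds A N (?x B j)) \<ge> 1 - \<delta>" if "j < m" for B j
    using ex stream[OF that] by (simp add: asymptotically_exact_F0_def succeeds_def)
  \<comment> \<open>\<open>measure\<close> is 0 outside the sigma-algebra, whereas the success
    probability is at least 1 - \<delta> > 0.\<close>
  have meas: "succeeds A N (?x B j) \<in> events" if "j < m" for B j
  proof (rule ccontr)
    assume "succeeds A N (?x B j) \<notin> events"
    then show False using pr[OF that, of B] \<delta> by (simp add: measure_notin_sets)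
  qed
  define hits where "hits w = (\<Sum>B\<in>Pow ?I. \<Sum>j\<in>?I. indicator (succeeds A N (?x B j)) w :: real)" for w
  have int: "integrable ?M (indicator (succeeds A N (?x B j)) :: _ \<Rightarrow> real)" if "j < m" for B j
    using meas[OF that] by (simp add: integrable_indicator_iff less_top[symmetric])
  have int_hits: "integrable ?M hits"
    unfolding hits_def by (intro Bochner_Integration.integrable_sum int) auto
  have "(1 - \<delta>) * real m * 2 ^ m = (\<Sum>B\<in>Pow ?I. \<Sum>j\<in>?I. 1 - \<delta>)"
    by (simp add: card_Pow)
  also have "\<dots> \<le> (\<Sum>B\<in>Pow ?I. \<Sum>j\<in>?I. prob (succeeds A N (?x B j)))"
    by (intro sum_mono pr) auto
  also have "\<dots> = (\<Sum>B\<in>Pow ?I. \<Sum>j\<in>?I. expectation (indicator (succeeds A N (?x B j))))"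
    by (intro sum.cong refl) (simp add: meas)
  also have "\<dots> = expectation hits"
  proof -
    have "expectation hits
        = (\<Sum>B\<in>Pow ?I. expectation (\<lambda>w. \<Sum>j\<in>?I. indicator (succeeds A N (?x B j)) w))"
      unfolding hits_def
      by (intro Bochner_Integration.integral_sum Bochner_Integration.integrable_sum int) auto
    also have "\<dots> = (\<Sum>B\<in>Pow ?I. \<Sum>j\<in>?I. expectation (indicator (succeeds A N (?x B j))))"
      by (intro sum.cong refl Bochner_Integration.integral_sum int) auto
    finally show ?thesis by (rule sym)
  qed
  finally have E: "(1 - \<delta>) * real m * 2 ^ m \<le> expectation hits" .
  \<comment> \<open>Only finitely many null sets are joined. Index 0 stands for every j, since the
    first n items do not depend on j.\<close>
  have "AE w in ?M. \<forall>B\<in>Pow ?I. real (length (memory A (?x B 0) w n)) \<le> r"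
    using n by (intro AE_finite_allI AE_length_memory_le[OF stream mem]) (auto simp: m_def)
  \<comment> \<open>If no outcome met both conditions, \<open>hits\<close> would lie strictly below
    the bound almost everywhere, and so would its expectation.\<close>
  then have "\<exists>w. (\<forall>B\<in>Pow ?I. real (length (memory A (?x B 0) w n)) \<le> r)
      \<and> (1 - \<delta>) * real m * 2 ^ m \<le> hits w"
  proof (rule contrapos_pp)
    assume none: "\<not> ?thesis"
    show "\<not> (AE w in ?M. \<forall>B\<in>Pow ?I. real (length (memory A (?x B 0) w n)) \<le> r)"
    proof
      assume "AE w in ?M. \<forall>B\<in>Pow ?I. real (length (memory A (?x B 0) w n)) \<le> r"
      then have "AE w in ?M. hits w < (1 - \<delta>) * real m * 2 ^ m"
        by (rule eventually_mono) (use none not_less in blast)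
      from expectation_less[OF int_hits this] E show False by linarith
    qed
  qed
  then obtain w where
    len: "\<And>B. B \<subseteq> ?I \<Longrightarrow> real (length (memory A (?x B 0) w n)) \<le> r"
    and hits: "(1 - \<delta>) * real m * 2 ^ m \<le> hits w"
    by blast
  define enc where "enc B = memory A (?x B 0) w n" for B
  \<comment> \<open>By \<open>same_memory_same_bit\<close>, all sets with code s on which w succeeds
    at j agree about j, so any one of them may decide the bit. If there is none, j is left out by
    default, and such pairs count nothing in \<open>hits\<close>.\<close>
  define dec where "dec s = {j. \<exists>B. enc B = s \<and> w \<in> succeeds A N (?x B j) \<and> j \<in> B}" for s
  have enc: "memory A (?x B j) w n = enc B" for B j
    unfolding enc_def by (rule memory_cong_prefix) (simp add: index_stream_def)
  have "hits w \<le> (\<Sum>B\<in>Pow ?I. real (agreement ?I B (dec (enc B))))"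
    unfolding hits_def
  proof (rule sum_mono)
    fix B
    have "(\<Sum>j\<in>?I. indicator (succeeds A N (?x B j)) w :: real)
        \<le> (\<Sum>j\<in>?I. of_bool (j \<in> dec (enc B) \<longleftrightarrow> j \<in> B))"
    proof (rule sum_mono)
      fix j assume "j \<in> ?I"
      then have j: "j < n div 2" by (simp add: m_def)
      have "j \<in> dec (enc B) \<longleftrightarrow> j \<in> B" if w: "w \<in> succeeds A N (?x B j)"
      proof
        assume "j \<in> dec (enc B)"
        then obtain B' where B': "enc B' = enc B" "w \<in> succeeds A N (?x B' j)" "j \<in> B'"
          by (auto simp: dec_def)
        then have "memory A (?x B' j) w n = memory A (?x B j) w n"
          by (simp only: enc)
        from same_memory_same_bit[OF B'(2) w j n(2) this] B'(3) show "j \<in> B" by simp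
      next
        assume "j \<in> B"
        then show "j \<in> dec (enc B)" using w unfolding dec_def by blast
      qed
      then show "indicator (succeeds A N (?x B j)) w
          \<le> (of_bool (j \<in> dec (enc B) \<longleftrightarrow> j \<in> B) :: real)"
        by (auto simp: indicator_def)
    qed
    also have "\<dots> = real (agreement ?I B (dec (enc B)))"
      unfolding agreement_def by (simp add: Int_def)
    finally show "(\<Sum>j\<in>?I. indicator (succeeds A N (?x B j)) w)
        \<le> real (agreement ?I B (dec (enc B)))" .
  qed
  \<comment> \<open>The excess over one half comes from 2(1 - \<delta>) = 1 + (1 -
    2\<delta>).\<close>
  with hits have "(\<Sum>B\<in>Pow ?I. 2 * real (agreement ?I B (dec (enc B))))
      \<ge> (1 + (1 - 2 * \<delta>)) * real (card ?I) * 2 ^ card ?I"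
    by (simp add: algebra_simps flip: sum_distrib_left)
  moreover have "enc B \<in> ?T" if "B \<subseteq> ?I" for B
    using len[OF that] by (simp add: enc_def le_nat_floor)
  ultimately have "exp ((1 - 2 * \<delta>)\<^sup>2 * real (card ?I) / 4) \<le> real (card ?T)"
    using \<delta> by (intro code_book_size[where enc = enc and dec = dec] finite_bool_lists_le) auto
  also have "\<dots> \<le> real (2 ^ (nat \<lfloor>r\<rfloor> + 1))"
    using card_bool_lists_le of_nat_le_iff by blast
  finally show ?thesis by (simp add: m_def)
qed

theorem theorem6:
  fixes A :: "nat \<Rightarrow> 'w stream_alg" and \<delta> :: real
  assumes "\<delta> < 1 / 2"
    and "\<And>N. N \<ge> 1 \<Longrightarrow> asymptotically_exact_F0 \<delta> N (A N)"
  shows "\<exists>c > 0. \<forall>\<^sub>F n in sequentially. \<forall>N \<ge> n. memory_bits (A N) N n \<ge> ereal (c * real n)"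
proof -
  have "0 \<le> \<delta>"
  \<comment> \<open>A probability is at most 1, so one legal stream suffices to give 1 - \<delta>
    \<le> 1.\<close>
  proof -
    have "prob_space (coins (A 1))" and "(\<lambda>_. 1) \<in> streams_over 1"
      using assms(2)[of 1]
      by (auto simp: asymptotically_exact_F0_def streaming_algorithm_def streams_over_def)
    moreover from this have "1 - \<delta> \<le> measure (coins (A 1)) (succeeds (A 1) 1 (\<lambda>_. 1))"
      using assms(2)[of 1] by (simp add: asymptotically_exact_F0_def succeeds_def)
    ultimately show ?thesis
      using prob_space.prob_le_1[of "coins (A 1)"] by (smt (verit))
  qed
  define \<eta> where "\<eta> = (1 - 2 * \<delta>)\<^sup>2"
  have \<eta>: "0 < \<eta>" "\<eta> \<le> 1"
    using assms(1) \<open>0 \<le> \<delta>\<close> by (auto simp: \<eta>_def power_le_one)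
  \<comment> \<open>The count yields roughly \<eta>n/8 \<le> cn + 1; half of \<eta>/8 leaves a
    linear surplus.\<close>
  define c where "c = \<eta> / 16"
  \<comment> \<open>With n div 2 \<ge> (n - 1)/2, the negation gives \<eta>n/4 \<le> 4 + \<eta>/2
    \<le> 9/2, which \<eta>n > 18 excludes.\<close>
  have "ereal (c * real n) \<le> memory_bits (A N) N n" if n: "real n > 18 / \<eta>" "n \<le> N" for n N
  proof (rule ccontr)
    assume "\<not> ?thesis"
    then have mem: "memory_bits (A N) N n \<le> ereal (c * real n)" by simp
    have big: "18 < \<eta> * real n" using n \<eta> by (simp add: divide_less_eq mult.commute)
    also have "\<dots> \<le> real n" using \<eta> by (simp add: mult_left_le_one_le)
    finally have "2 \<le> n" "1 \<le> N" using n by auto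
    have "exp (\<eta> * real (n div 2) / 4) \<le> 2 ^ (nat \<lfloor>c * real n\<rfloor> + 1)"
      unfolding \<eta>_def
      by (rule memory_exponential[OF assms(2)[OF \<open>1 \<le> N\<close>] \<open>0 \<le> \<delta>\<close> assms(1) \<open>2 \<le> n\<close> n(2) mem])
    \<comment> \<open>Replacing base 2 by e lets the exponents be compared directly, at the cost of
      a constant factor.\<close>
    also have "\<dots> \<le> exp 1 ^ (nat \<lfloor>c * real n\<rfloor> + 1)"
      using exp_ge_add_one_self[of 1] by (intro power_mono) auto
    also have "\<dots> = exp (real (nat \<lfloor>c * real n\<rfloor> + 1))"
      by (subst exp_of_nat_mult[symmetric]) simp
    finally have "\<eta> * real (n div 2) / 4 \<le> real (nat \<lfloor>c * real n\<rfloor> + 1)" by simp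
    also have "\<dots> \<le> c * real n + 1"
      using of_nat_floor[of "c * real n"] \<eta> by (simp add: c_def)
    finally have "\<eta> * real (n div 2) \<le> \<eta> * real n / 4 + 4" by (simp add: c_def)
    moreover have "\<eta> * (real n / 2 - 1 / 2) \<le> \<eta> * real (n div 2)"
      using \<eta> by (intro mult_left_mono) linarith+
    ultimately show False using big \<eta> by (simp add: algebra_simps)
  qed
  moreover have "\<forall>\<^sub>F n in sequentially. real n > 18 / \<eta>"
    by (rule eventually_compose_filterlim[OF eventually_gt_at_top filterlim_real_sequentially])
  ultimately show ?thesis
    using \<eta> by (intro exI[of _ c]) (auto simp: c_def elim: eventually_mono)
qed

end
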